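(* Let $\mathcal{G}$ be a chordal graph with vertex set $I=\{1,\dots,n\}$, and suppose that the usual ordering of $\{1,\dots,n\}$ is a perfect elimination ordering of $\mathcal{G}$. Then for any integer $q\ge 1$, $$I(\mathcal{G},\mathbf{x})^{-q}=\sum_{\mathbf{m}\ge 0}(-1)^{|\mathbf{m}|}\prod_{r=1}^{n}\binom{q-1+a_r(\mathbf{m})}{m_r}\,\mathbf{x}^{\mathbf{m}}$$ in $\mathbb{Q}[[x_i : i\in I]]$, where $a_r(\mathbf{m})=m_r+\sum_{1\le s<r,\ s\sim r}m_s$ for $1\le r\le n$, and $s\sim r$ means that $s$ and $r$ are joined by an edge of $\mathcal{G}$. In particular, $I(\mathcal{G},\mathbf{x})^{-q}$ is a Horn hypergeometric series for all $q\ge 1$.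
   Context: All graphs are finite and simple. A graph is chordal if it has no induced subgraph isomorphic to a cycle graph $C_m$ with $m\ge 4$. A total ordering $\le$ on the vertex set $I$ is a perfect elimination ordering if for each $k\in I$ the subgraph induced by $k$ together with all vertices $i\le k$ adjacent to $k$ is a clique (complete subgraph). The multi-variate independence polynomial is $I(\mathcal{G},\mathbf{x})=\sum_{S\in\mathcal{I}(\mathcal{G})}\prod_{i\in S}x_i\in R=\mathbb{Q}[[x_i : i\in I]]$, where $\mathcal{I}(\mathcal{G})$ is the set of independent subsets of $I$ (subsets spanning no edges, including $\emptyset$ and singletons). It has constant term $1$, hence is invertible in $R$. For an $I$-tuple of integers $\mathbf{m}=(m_i : i\in I)$: $\mathbf{m}\ge 0$ means all $m_i\ge 0$; $|\mathbf{m}|=\sum_i m_i$; $\mathbf{x}^{\mathbf{m}}=\prod_{i\in I}x_i^{m_i}$; $\mathrm{supp}(\mathbf{m})=\{i\in I : m_i\neq 0\}$; $\mathbf{e}_i=(\delta_{ji} : j\in I)$. A power series $F(\mathbf{x})=\sum_{\mathbf{m}\ge 0}c_{\mathbf{m}}\mathbf{x}^{\mathbf{m}}\in R$ is called Horn hypergeometric if (i) $c_{\mathbf{m}}\neq 0$ for all $\mathbf{m}\ge 0$, and (ii) $c_{\mathbf{m}+\mathbf{e}_i}/c_{\mathbf{m}}$ is a rational function of $\{m_j : j\in\mathrm{supp}(\mathbf{m})\}$ for each $i\in\mathrm{supp}(\mathbf{m})$; that is, for every $J\subseteq I$ and $i\in J$ there is a rational function over $\mathbb{Q}$ in the variables $m_j$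 ($j\in J$) whose value at $\mathbf{m}$ is defined and equal to $c_{\mathbf{m}+\mathbf{e}_i}/c_{\mathbf{m}}$ for all $\mathbf{m}\ge 0$ with $\mathrm{supp}(\mathbf{m})=J$. *)

theory Defs
  imports
    Complex_Main
    "HOL-Library.Poly_Mapping"
    "Graph_Theory.Graph_Theory"
begin

section \<open>Formal power series in several variables\<close>

text \<open>
  Exponents are finitely supported functions \<open>'v \<Rightarrow>\<^sub>0 nat\<close>, so \<open>('v, 'a) mfps\<close> is
  the ring of formal power series over \<open>'a\<close> in the variables \<open>x\<^sub>v\<close>, \<open>v :: 'v\<close>; the type \<open>'v\<close>
  need not be finite.  For a finite set \<open>I\<close> of variables, the ring of power series in \<open>x\<^sub>i\<close>,
  \<open>i \<in> I\<close>, is the subring \<open>mfps_over I\<close> defined below.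
\<close>

typedef ('v, 'a) mfps = "UNIV :: (('v \<Rightarrow>\<^sub>0 nat) \<Rightarrow> 'a) set"
  morphisms mfps_coeff Abs_mfps ..

setup_lifting type_definition_mfps

lemma mfps_eqI: "(\<And>m. mfps_coeff f m = mfps_coeff g m) \<Longrightarrow> f = g"
  by (rule mfps_coeff_inject[THEN iffD1]) (rule ext)

lemma finite_exponent_pairs: "finite {(a, b). a + b = (m :: 'v \<Rightarrow>\<^sub>0 nat)}"
proof -
  define M where "M = Max (Poly_Mapping.lookup m ` Poly_Mapping.keys m)"
  define F where "F = {f :: 'v \<Rightarrow> nat. \<forall>x. (x \<in> Poly_Mapping.keys m \<longrightarrow> f x \<in> {..M}) \<and>
                                          (x \<notin> Poly_Mapping.keys m \<longrightarrow> f x = 0)}"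
  have mem: "Poly_Mapping.lookup a \<in> F" if "a + b = m" for a b
  proof -
    have le: "Poly_Mapping.lookup a x \<le> Poly_Mapping.lookup m x" for x
      unfolding that[symmetric] lookup_add by (rule le_add1)
    have "Poly_Mapping.lookup a x \<le> M" if "x \<in> Poly_Mapping.keys m" for x
      unfolding M_def by (rule order.trans[OF le Max_ge]) (use that in auto)
    moreover have "Poly_Mapping.lookup a x = 0" if "x \<notin> Poly_Mapping.keys m" for x
      using le[of x] that by (simp add: in_keys_iff)
    ultimately show ?thesis by (simp add: F_def)
  qed
  have "finite F"
    unfolding F_def by (rule finite_set_of_finite_funs[OF finite_keys finite_atMost])
  have fin: "finite (Poly_Mapping.lookup -` F)"
    apply (rule finite_vimageI[OF \<open>finite F\<close>])
    apply (rule injI)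
    apply (erule lookup_inject[THEN iffD1])
    done
  have "a + b = m \<Longrightarrow> Poly_Mapping.lookup a \<in> F \<and> Poly_Mapping.lookup b \<in> F" for a b
    using mem[of a b] mem[of b a] by (simp add: add.commute)
  then have "{(a, b). a + b = m} \<subseteq> (Poly_Mapping.lookup -` F) \<times> (Poly_Mapping.lookup -` F)"
    by blast
  from finite_subset[OF this] show ?thesis
    using fin by simp
qed

lemma mfps_conv_commute:
  fixes f g :: "('v \<Rightarrow>\<^sub>0 nat) \<Rightarrow> 'a::comm_ring_1"
  shows "(\<Sum>(a, b)\<in>{(a, b). a + b = m}. f a * g b) = (\<Sum>(a, b)\<in>{(a, b). a + b = m}. g a * f b)"
  by (rule sum.reindex_bij_witness[of _ prod.swap prod.swap]) (auto simp: add.commute mult.commute)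

lemma mfps_conv_assoc:
  fixes f g h :: "('v \<Rightarrow>\<^sub>0 nat) \<Rightarrow> 'a::comm_ring_1"
  shows "(\<Sum>(u, c)\<in>{(u, c). u + c = m}. (\<Sum>(a, b)\<in>{(a, b). a + b = u}. f a * g b) * h c) =
         (\<Sum>(a, u)\<in>{(a, u). a + u = m}. f a * (\<Sum>(b, c)\<in>{(b, c). b + c = u}. g b * h c))"
proof -
  have fin: "finite {p. fst p + snd p = (u :: 'v \<Rightarrow>\<^sub>0 nat)}" for u
    using finite_exponent_pairs[of u] by (simp add: case_prod_unfold)
  have "(\<Sum>(u, c)\<in>{(u, c). u + c = m}. (\<Sum>(a, b)\<in>{(a, b). a + b = u}. f a * g b) * h c) =
        (\<Sum>(p, q)\<in>(SIGMA p:{p. fst p + snd p = m}. {q. fst q + snd q = fst p}).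
            f (fst q) * g (snd q) * h (snd p))"
    by (subst sum.Sigma[symmetric]) (simp_all add: fin sum_distrib_right case_prod_unfold)
  also have "\<dots> = (\<Sum>(p, q)\<in>(SIGMA p:{p. fst p + snd p = m}. {q. fst q + snd q = snd p}).
            f (fst p) * (g (fst q) * h (snd q)))"
    by (rule sum.reindex_bij_witness
          [of _ "\<lambda>((a, u), (b, c)). ((a + b, c), (a, b))" "\<lambda>((u, c), (a, b)). ((a, b + c), (b, c))"])
      (auto simp: algebra_simps)
  also have "\<dots> = (\<Sum>(a, u)\<in>{(a, u). a + u = m}. f a * (\<Sum>(b, c)\<in>{(b, c). b + c = u}. g b * h c))"
    by (subst sum.Sigma[symmetric]) (simp_all add: fin sum_distrib_left case_prod_unfold)
  finally show ?thesis .
qed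

lemma mfps_conv_one:
  fixes f :: "('v \<Rightarrow>\<^sub>0 nat) \<Rightarrow> 'a::comm_ring_1"
  shows "(\<Sum>(a, b)\<in>{(a, b). a + b = m}. (if a = 0 then 1 else 0) * f b) = f m"
proof -
  have "(\<Sum>(a, b)\<in>{(a, b). a + b = m}. (if a = 0 then 1 else 0) * f b) =
        (\<Sum>(a, b)\<in>{(0 :: 'v \<Rightarrow>\<^sub>0 nat, m)}. (if a = 0 then 1 else 0) * f b)"
    by (rule sum.mono_neutral_right) (auto simp: finite_exponent_pairs split: if_splits)
  then show ?thesis by simp
qed

instantiation mfps :: (type, comm_ring_1) comm_ring_1
begin

lift_definition zero_mfps :: "('a, 'b) mfps" is "\<lambda>_. 0" .
lift_definition one_mfps :: "('a, 'b) mfps" is "\<lambda>m. if m = 0 then 1 else 0" .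
lift_definition plus_mfps :: "('a, 'b) mfps \<Rightarrow> ('a, 'b) mfps \<Rightarrow> ('a, 'b) mfps"
  is "\<lambda>f g m. f m + g m" .
lift_definition minus_mfps :: "('a, 'b) mfps \<Rightarrow> ('a, 'b) mfps \<Rightarrow> ('a, 'b) mfps"
  is "\<lambda>f g m. f m - g m" .
lift_definition uminus_mfps :: "('a, 'b) mfps \<Rightarrow> ('a, 'b) mfps"
  is "\<lambda>f m. - f m" .
lift_definition times_mfps :: "('a, 'b) mfps \<Rightarrow> ('a, 'b) mfps \<Rightarrow> ('a, 'b) mfps"
  is "\<lambda>f g m. \<Sum>(a, b)\<in>{(a, b). a + b = m}. f a * g b" .

instance
proof
  fix f g h :: "('a, 'b) mfps"
  show "f + g + h = f + (g + h)" "f + g = g + f" "0 + f = f" "- f + f = 0" "f - g = f + - g"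
    by (transfer; simp add: algebra_simps)+
  show "f * g * h = f * (g * h)"
    by transfer (simp add: mfps_conv_assoc)
  show "f * g = g * f"
    by (transfer, rule ext) (rule mfps_conv_commute)
  show "1 * f = f"
    by transfer (simp add: mfps_conv_one)
  show "(f + g) * h = f * h + g * h"
    by transfer (simp add: distrib_right sum.distrib case_prod_unfold)
  show "(0 :: ('a, 'b) mfps) \<noteq> 1"
    by transfer (metis zero_neq_one)
qed

end

lemma mfps_coeff_mult:
  "mfps_coeff (f * g) m = (\<Sum>(a, b)\<in>{(a, b). a + b = m}. mfps_coeff f a * mfps_coeff g b)"
  by (simp add: times_mfps.rep_eq)

text \<open>
  The inverse in the ring of power series; as usual in HOL, non-units get the value \<open>0\<close>.
  Lemma \<open>mfps_right_inverse\<close> below shows that every series with nonzero constant term is a unit.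
\<close>

instantiation mfps :: (type, field) inverse
begin

definition inverse_mfps :: "('a, 'b) mfps \<Rightarrow> ('a, 'b) mfps" where
  "inverse_mfps f = (if f dvd 1 then THE g. f * g = 1 else 0)"

definition divide_mfps :: "('a, 'b) mfps \<Rightarrow> ('a, 'b) mfps \<Rightarrow> ('a, 'b) mfps" where
  "divide_mfps f g = f * inverse g"

instance ..

end

lift_definition mfps_X :: "'v \<Rightarrow> ('v, 'a::comm_ring_1) mfps" is
  "\<lambda>i m. if m = Poly_Mapping.single i 1 then 1 else 0" .

definition mfps_over :: "'v set \<Rightarrow> ('v, 'a::comm_ring_1) mfps set" where
  "mfps_over I = {F. \<forall>m. mfps_coeff F m \<noteq> 0 \<longrightarrow> Poly_Mapping.keys m \<subseteq> I}"

text \<open>The series \<open>\<Sum>c\<^sub>m x\<^sup>m\<close>, summed over all exponents \<open>m\<close> in the variables \<open>x\<^sub>i\<close>, \<open>i \<in> I\<close>.\<close>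

lift_definition mfps_series :: "'v set \<Rightarrow> (('v \<Rightarrow>\<^sub>0 nat) \<Rightarrow> 'a) \<Rightarrow> ('v, 'a::comm_ring_1) mfps" is
  "\<lambda>I c m. if Poly_Mapping.keys m \<subseteq> I then c m else 0" .

definition exponent_degree :: "('v \<Rightarrow>\<^sub>0 nat) \<Rightarrow> nat" where
  "exponent_degree m = (\<Sum>i\<in>Poly_Mapping.keys m. Poly_Mapping.lookup m i)"

lemma exponent_degree_add: "exponent_degree (a + b) = exponent_degree a + exponent_degree b"
  unfolding exponent_degree_def
  using setsum_keys_plus_distrib[of "\<lambda>_ n. n" a b] by simp

lemma exponent_degree_eq_0_iff: "exponent_degree m = 0 \<longleftrightarrow> m = 0"
proof
  assume "exponent_degree m = 0"
  then show "m = 0"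
    by (intro poly_mapping_eqI) (auto simp: exponent_degree_def in_keys_iff)
qed (simp add: exponent_degree_def)

lemma exponent_add_eq_0_iff: "a + b = (0 :: 'v \<Rightarrow>\<^sub>0 nat) \<longleftrightarrow> a = 0 \<and> b = 0"
  by (metis add_eq_0_iff_both_eq_0 exponent_degree_add exponent_degree_eq_0_iff)

lemma mfps_coeff_mult_0:
  fixes f g :: "('v, 'a::comm_ring_1) mfps"
  shows "mfps_coeff (f * g) 0 = mfps_coeff f 0 * mfps_coeff g 0"
proof -
  have "{(a, b). a + b = (0 :: 'v \<Rightarrow>\<^sub>0 nat)} = {(0, 0)}"
    by (auto simp: exponent_add_eq_0_iff)
  then show ?thesis by (simp add: mfps_coeff_mult)
qed

lemma mfps_coeff_power_eq_0:
  fixes h :: "('v, 'a::comm_ring_1) mfps"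
  assumes "mfps_coeff h 0 = 0" "exponent_degree m < k"
  shows "mfps_coeff (h ^ k) m = 0"
  using assms(2)
proof (induction k arbitrary: m)
  case (Suc k)
  have "mfps_coeff h a * mfps_coeff (h ^ k) b = 0" if "a + b = m" for a b
  proof (cases "a = 0")
    case False
    then have "exponent_degree a \<noteq> 0"
      by (simp add: exponent_degree_eq_0_iff)
    then have "exponent_degree b < k"
      using that Suc.prems exponent_degree_add[of a b] by simp
    then show ?thesis by (simp add: Suc.IH)
  qed (simp add: assms(1))
  then show ?case
    unfolding power_Suc mfps_coeff_mult by (intro sum.neutral) fast
qed simp

lemma mfps_coeff_sum:
  fixes F :: "'b \<Rightarrow> ('v, 'a::comm_ring_1) mfps"
  shows "mfps_coeff (\<Sum>k\<in>A. F k) m = (\<Sum>k\<in>A. mfps_coeff (F k) m)"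
  by (induction A rule: infinite_finite_induct)
    (simp_all add: zero_mfps.rep_eq plus_mfps.rep_eq)

lemma mfps_geometric_inverse:
  fixes h :: "('v, 'a::comm_ring_1) mfps"
  assumes h0: "mfps_coeff h 0 = 0"
  shows "1 - h dvd 1"
proof -
  define S where "S N = (\<Sum>k\<le>N. h ^ k)" for N
  define g where "g = Abs_mfps (\<lambda>m. mfps_coeff (S (exponent_degree m)) m)"
  have g: "mfps_coeff g m = mfps_coeff (S N) m" if "exponent_degree m \<le> N" for m N
  proof -
    have "mfps_coeff (S N) m = mfps_coeff (S (exponent_degree m)) m"
      unfolding S_def mfps_coeff_sum
      by (rule sum.mono_neutral_right) (use that mfps_coeff_power_eq_0[OF h0] in auto)
    then show ?thesis by (simp add: g_def Abs_mfps_inverse)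
  qed
  have "(1 - h) * g = 1"
  proof (rule mfps_eqI)
    fix m :: "'v \<Rightarrow>\<^sub>0 nat"
    let ?N = "exponent_degree m"
    have "mfps_coeff g b = mfps_coeff (S ?N) b" if "a + b = m" for a b
      using that by (intro g) (auto simp: exponent_degree_add)
    then have "mfps_coeff ((1 - h) * g) m = mfps_coeff ((1 - h) * S ?N) m"
      unfolding mfps_coeff_mult by (intro sum.cong) auto
    also have "(1 - h) * S ?N = 1 - h ^ Suc ?N"
      unfolding S_def by (rule sum_gp_basic)
    also have "mfps_coeff (1 - h ^ Suc ?N) m = mfps_coeff 1 m"
      by (simp only: minus_mfps.rep_eq) (simp add: mfps_coeff_power_eq_0[OF h0] del: power_Suc)
    finally show "mfps_coeff ((1 - h) * g) m = mfps_coeff 1 m" .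
  qed
  then show ?thesis by (metis dvdI)
qed

lemma mfps_right_inverse:
  fixes f :: "('v, 'a::field) mfps"
  assumes "mfps_coeff f 0 \<noteq> 0"
  shows "f * inverse f = 1"
proof -
  define c :: "('v, 'a) mfps" where "c = Abs_mfps (\<lambda>m. if m = 0 then inverse (mfps_coeff f 0) else 0)"
  have "mfps_coeff (1 - c * f) 0 = 0"
    using assms
    by (simp add: minus_mfps.rep_eq one_mfps.rep_eq mfps_coeff_mult_0 c_def Abs_mfps_inverse)
  from mfps_geometric_inverse[OF this] have "c * f dvd 1" by simp
  then have unit: "f dvd 1" by (rule dvd_mult_right)
  then obtain g where g: "f * g = 1" by (metis dvdE)
  have "\<exists>!g. f * g = 1"
  proof (rule ex1I)
    show "f * g = 1" by (rule g)
  next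
    fix g' assume "f * g' = 1"
    then have "g * (f * g') = g" by simp
    then show "g' = g" using g by (simp add: mult.assoc[symmetric] mult.commute)
  qed
  from theI'[OF this] unit show ?thesis by (simp add: inverse_mfps_def)
qed

section \<open>Horn hypergeometric series\<close>

text \<open>
  Polynomials over \<open>\<rat>\<close> are finitely supported families of coefficients, indexed by the same
  exponents as above.
\<close>

type_synonym 'v ratpoly = "('v \<Rightarrow>\<^sub>0 nat) \<Rightarrow>\<^sub>0 rat"

definition ratpoly_in :: "'v set \<Rightarrow> 'v ratpoly set" where
  "ratpoly_in J = {p. \<forall>t\<in>Poly_Mapping.keys p. Poly_Mapping.keys t \<subseteq> J}"

definition ratpoly_eval :: "'v ratpoly \<Rightarrow> ('v \<Rightarrow> rat) \<Rightarrow> rat" where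
  "ratpoly_eval p x = (\<Sum>t\<in>Poly_Mapping.keys p. Poly_Mapping.lookup p t *
     (\<Prod>j\<in>Poly_Mapping.keys t. x j ^ Poly_Mapping.lookup t j))"

text \<open>
  The rational function attached to \<open>J\<close> and \<open>i\<close> is \<open>P / Q\<close>. One representation serves all
  arguments: in lowest terms the denominator is nonzero wherever the function is defined.
\<close>

definition horn_hypergeometric :: "'v set \<Rightarrow> ('v, rat) mfps \<Rightarrow> bool" where
  "horn_hypergeometric I F \<longleftrightarrow>
     F \<in> mfps_over I \<and>
     (\<forall>m. Poly_Mapping.keys m \<subseteq> I \<longrightarrow> mfps_coeff F m \<noteq> 0) \<and>
     (\<forall>J\<subseteq>I. \<forall>i\<in>J. \<exists>P\<in>ratpoly_in J. \<exists>Q\<in>ratpoly_in J. Q \<noteq> 0 \<and>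
        (\<forall>m. Poly_Mapping.keys m = J \<longrightarrow>
           ratpoly_eval Q (\<lambda>j. of_nat (Poly_Mapping.lookup m j)) \<noteq> 0 \<and>
           mfps_coeff F (m + Poly_Mapping.single i 1) / mfps_coeff F m =
             ratpoly_eval P (\<lambda>j. of_nat (Poly_Mapping.lookup m j)) /
             ratpoly_eval Q (\<lambda>j. of_nat (Poly_Mapping.lookup m j))))"

section \<open>Graphs\<close>

text \<open>
  A finite simple graph is a \<^locale>\<open>graph\<close>, i.e. a finite symmetric digraph
  without loops and multiple arcs; adjacency is \<open>u \<rightarrow>\<^bsub>G\<^esub> v\<close>.
\<close>

definition cycle_graph :: "nat \<Rightarrow> (nat, nat \<times> nat) pre_digraph" where
  "cycle_graph m =
     \<lparr> verts = {0..<m},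
       arcs = {(i, j). i < m \<and> j < m \<and> (j = Suc i mod m \<or> i = Suc j mod m)},
       tail = fst, head = snd \<rparr>"

lemma graph_cycle_graph:
  assumes "m \<ge> 3"
  shows "graph (cycle_graph m)"
proof
  have "arcs (cycle_graph m) \<subseteq> {0..<m} \<times> {0..<m}"
    by (auto simp: cycle_graph_def)
  then show "finite (arcs (cycle_graph m))"
    by (rule finite_subset) simp
  show "tail (cycle_graph m) e \<noteq> head (cycle_graph m) e" if "e \<in> arcs (cycle_graph m)" for e
    using that assms by (auto simp: cycle_graph_def mod_Suc split: if_splits)
  show "symmetric (cycle_graph m)"
    by (auto simp: symmetric_conv cycle_graph_def)
qed (auto simp: cycle_graph_def arc_to_ends_def)

definition chordal :: "('a, 'b) pre_digraph \<Rightarrow> bool" where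
  "chordal G \<longleftrightarrow> \<not> (\<exists>H m. induced_subgraph H G \<and> m \<ge> 4 \<and> digraph_iso H (cycle_graph m))"

definition perfect_elimination_ordering :: "('a, 'b) pre_digraph \<Rightarrow> ('a \<times> 'a) set \<Rightarrow> bool" where
  "perfect_elimination_ordering G r \<longleftrightarrow>
     linear_order_on (verts G) r \<and>
     (\<forall>k\<in>verts G.
        let W = insert k {i\<in>verts G. (i, k) \<in> r \<and> i \<rightarrow>\<^bsub>G\<^esub> k}
        in complete_digraph (card W) (G \<restriction> W))"

definition independent_sets :: "('a, 'b) pre_digraph \<Rightarrow> 'a set set" where
  "independent_sets G = {S. S \<subseteq> verts G \<and> (\<forall>u\<in>S. \<forall>v\<in>S. \<not> u \<rightarrow>\<^bsub>G\<^esub> v)}"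

definition independence_poly :: "('a, 'b) pre_digraph \<Rightarrow> ('a, rat) mfps" where
  "independence_poly G = (\<Sum>S\<in>independent_sets G. \<Prod>i\<in>S. mfps_X i)"

lemma independence_poly_const_coeff:
  assumes "graph G"
  shows "mfps_coeff (independence_poly G) 0 = 1"
proof -
  interpret graph G by fact
  have fin: "finite (independent_sets G)"
    by (rule finite_subset[of _ "Pow (verts G)"]) (auto simp: independent_sets_def)
  have X: "mfps_coeff (mfps_X i :: ('a, rat) mfps) 0 = 0" for i
  proof -
    have "Poly_Mapping.lookup (Poly_Mapping.single i (1::nat)) i \<noteq> Poly_Mapping.lookup 0 i"
      by simp
    then have "Poly_Mapping.single i (1::nat) \<noteq> 0" by metis
    then show ?thesis by (simp add: mfps_X.rep_eq)
  qed
  have const: "mfps_coeff (\<Prod>i\<in>S. mfps_X i :: ('a, rat) mfps) 0 = (if S = {} then 1 else 0)"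
    if "S \<in> independent_sets G" for S
  proof -
    have "finite S"
      using that finite_subset[OF _ finite_verts] by (auto simp: independent_sets_def)
    then show ?thesis
      by (cases rule: finite.cases) (auto simp: one_mfps.rep_eq mfps_coeff_mult_0 X prod.insert_remove)
  qed
  have "mfps_coeff (independence_poly G) 0 = (\<Sum>S\<in>independent_sets G. if S = {} then 1 else 0)"
    unfolding independence_poly_def mfps_coeff_sum by (rule sum.cong) (simp_all add: const)
  then show ?thesis
    using fin by (simp add: independent_sets_def)
qed

text \<open>The number \<open>a\<^sub>r(m) = m\<^sub>r + \<Sum>m\<^sub>s\<close>, summed over the neighbours \<open>s\<close> of \<open>r\<close> with \<open>1 \<le> s < r\<close>.\<close>

definition lower_nbr_sum :: "(nat, 'b) pre_digraph \<Rightarrow> (nat \<Rightarrow>\<^sub>0 nat) \<Rightarrow> nat \<Rightarrow> nat" where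
  "lower_nbr_sum G m r = Poly_Mapping.lookup m r +
     (\<Sum>s | 1 \<le> s \<and> s < r \<and> s \<rightarrow>\<^bsub>G\<^esub> r. Poly_Mapping.lookup m s)"

end

theory Submission
  imports Defs
begin

text \<open>
  Write \<open>F\<^sub>q\<close> for the series on the right-hand side. It suffices to show
  \<open>I(G, x) F\<^sub>q\<^sub>+\<^sub>1 = F\<^sub>q\<close> and \<open>F\<^sub>0 = 1\<close>. The coefficient of \<open>x\<^sup>m\<close> in \<open>I(G, x) F\<^sub>q\<^sub>+\<^sub>1\<close> is
  an alternating sum over the independent sets \<open>S\<close> inside the support of \<open>m\<close>, in which the \<open>r\<close>-th
  binomial factor depends only on \<open>S \<inter> {1..r}\<close>. Fix the part \<open>S'\<close> of \<open>S\<close> below the last vertex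
  \<open>k\<close>. If \<open>S'\<close> meets the lower neighbours of \<open>k\<close>, it does so in exactly one vertex, as they form
  a clique; then \<open>k \<notin> S\<close>, and the \<open>k\<close>-th factor is the one of \<open>F\<^sub>q\<close>. Otherwise
  the choices \<open>k \<notin> S\<close> and \<open>k \<in> S\<close> combine to that same factor by Pascal's rule. So the last factor
  can be split off, and one concludes by induction on the number of vertices.
\<close>

section \<open>Multiplication by squarefree monomials\<close>

text \<open>Leaves a single pair in the convolution with \<open>mfps_X i\<close>. The condition on
  \<open>keys\<close> makes the truncated subtraction reversible.\<close>

lemma single_one_add_eq_iff:
  "Poly_Mapping.single i (1::nat) + b = m \<longleftrightarrow>
     i \<in> Poly_Mapping.keys m \<and> b = m - Poly_Mapping.single i 1"
proof
  assume *: "Poly_Mapping.single i (1::nat) + b = m"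
  show "i \<in> Poly_Mapping.keys m \<and> b = m - Poly_Mapping.single i 1"
    unfolding *[symmetric] by (simp add: in_keys_iff lookup_add)
next
  assume *: "i \<in> Poly_Mapping.keys m \<and> b = m - Poly_Mapping.single i 1"
  show "Poly_Mapping.single i (1::nat) + b = m"
    by (rule poly_mapping_eqI)
      (use * in \<open>auto simp: lookup_add lookup_minus lookup_single when_def in_keys_iff\<close>)
qed

lemma mfps_coeff_X_mult:
  "mfps_coeff (mfps_X i * F) m =
     (if i \<in> Poly_Mapping.keys m then mfps_coeff F (m - Poly_Mapping.single i 1) else 0)"
proof (cases "i \<in> Poly_Mapping.keys m")
  case True
  have "mfps_coeff (mfps_X i * F) m =
    (\<Sum>(a, b)\<in>{(Poly_Mapping.single i 1, m - Poly_Mapping.single i 1)}.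
       mfps_coeff (mfps_X i) a * mfps_coeff F b)"
    unfolding mfps_coeff_mult
    by (rule sum.mono_neutral_right)
      (use True in \<open>auto simp: finite_exponent_pairs mfps_X.rep_eq single_one_add_eq_iff
        simp del: One_nat_def split: if_splits\<close>)
  with True show ?thesis by (simp add: mfps_X.rep_eq)
next
  case False
  then have "mfps_coeff (mfps_X i * F) m = 0"
    unfolding mfps_coeff_mult
    by (intro sum.neutral) (auto simp: mfps_X.rep_eq single_one_add_eq_iff simp del: One_nat_def)
  with False show ?thesis by simp
qed

lemma mfps_coeff_prod_X_mult:
  assumes "finite S"
  shows "mfps_coeff ((\<Prod>i\<in>S. mfps_X i) * F) m =
    (if S \<subseteq> Poly_Mapping.keys m
     then mfps_coeff F (m - (\<Sum>i\<in>S. Poly_Mapping.single i 1)) else 0)"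
  using assms
proof (induction S arbitrary: m)
  case (insert i S)
  \<comment> \<open>Lowering the exponent of \<open>i\<close> removes no index of \<open>S\<close>
    from the support, because \<open>i\<close> is not in \<open>S\<close>.\<close>
  have keys: "S \<subseteq> Poly_Mapping.keys (m - Poly_Mapping.single i 1) \<longleftrightarrow> S \<subseteq> Poly_Mapping.keys m"
    using insert.hyps(2) by (auto simp: in_keys_iff lookup_minus lookup_single when_def subset_iff)
  have "mfps_coeff ((\<Prod>i\<in>insert i S. mfps_X i) * F) m =
        mfps_coeff (mfps_X i * ((\<Prod>i\<in>S. mfps_X i) * F)) m"
    using insert.hyps by (simp add: mult.assoc)
  also have "\<dots> = (if insert i S \<subseteq> Poly_Mapping.keys m
     then mfps_coeff F (m - (\<Sum>i\<in>insert i S. Poly_Mapping.single i 1)) else 0)"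
    unfolding mfps_coeff_X_mult insert.IH keys using insert.hyps by (simp add: diff_diff_add)
  finally show ?case .
qed simp

lemma lookup_sum_single_one:
  assumes "finite S"
  shows "Poly_Mapping.lookup (\<Sum>i\<in>S. Poly_Mapping.single i (1::nat)) r = of_bool (r \<in> S)"
  using assms by (simp add: lookup_sum lookup_single when_def)

section \<open>The alternating sum over independent sets\<close>

text \<open>Positivity of \<open>f\<close> on \<open>S\<close> keeps every truncated subtraction
  exact. Applied both to sums over lower neighbours and to the total degree.\<close>

lemma sum_decrement_on_subset:
  fixes f :: "'a \<Rightarrow> nat"
  assumes "finite A" and "\<And>s. s \<in> S \<Longrightarrow> f s > 0"
  shows "(\<Sum>s\<in>A. f s - of_bool (s \<in> S)) = (\<Sum>s\<in>A. f s) - card (A \<inter> S)"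
proof -
  have "(\<Sum>s\<in>A. f s - of_bool (s \<in> S)) = (\<Sum>s\<in>A. f s) - (\<Sum>s\<in>A. of_bool (s \<in> S))"
    by (rule sum_subtractf_nat) (use assms(2) in \<open>auto simp: Suc_le_eq\<close>)
  also have "(\<Sum>s\<in>A. of_bool (s \<in> S)) = card (A \<inter> S)"
    using assms(1) by (simp add: sum.inter_restrict[symmetric] of_bool_def)
  finally show ?thesis .
qed

text \<open>
  Here \<open>N r\<close> is the set of lower neighbours of \<open>r\<close>. On the right-hand side \<open>q = 0\<close> is allowed
  although \<open>q + m r + \<dots> - 1\<close> is a truncated subtraction: where it truncates, \<open>m r = 0\<close>.
\<close>

lemma alternating_sum_independent:
  fixes N :: "nat \<Rightarrow> nat set" and m :: "nat \<Rightarrow> nat" and q :: nat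
  assumes N_less: "\<And>r. N r \<subseteq> {1..<r}"
    and clique: "\<And>r s t. s \<in> N r \<Longrightarrow> t \<in> N r \<Longrightarrow> s < t \<Longrightarrow> s \<in> N t"
  shows "(\<Sum>S | S \<subseteq> {1..k} \<and> (\<forall>r\<in>S. N r \<inter> S = {} \<and> m r > 0).
            (-1) ^ card S * (\<Prod>r=1..k. of_nat
              ((q + (m r - of_bool (r \<in> S)) + (\<Sum>s\<in>N r. m s - of_bool (s \<in> S)))
                choose (m r - of_bool (r \<in> S))))) =
         (\<Prod>r=1..k. of_nat ((q + m r + (\<Sum>s\<in>N r. m s) - 1) choose m r) :: 'a :: comm_ring_1)"
proof (induction k)
  case 0
  have "{S. S \<subseteq> {1..0::nat} \<and> (\<forall>r\<in>S. N r \<inter> S = {} \<and> m r > 0)} = {{}}" by auto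
  then show ?case by simp
next
  case (Suc k)
  define Ind where "Ind k = {S. S \<subseteq> {1..k} \<and> (\<forall>r\<in>S. N r \<inter> S = {} \<and> m r > 0)}" for k :: nat
  \<comment> \<open>\<open>b S r\<close> is the factor of vertex \<open>r\<close> in the summand of
    \<open>S\<close>, and \<open>c r\<close> the factor claimed for it; \<open>w S\<close> leaves
    out the factor of \<open>Suc k\<close>.\<close>
  define b :: "nat set \<Rightarrow> nat \<Rightarrow> 'a" where "b S r = of_nat
    ((q + (m r - of_bool (r \<in> S)) + (\<Sum>s\<in>N r. m s - of_bool (s \<in> S)))
      choose (m r - of_bool (r \<in> S)))" for S r
  define c :: "nat \<Rightarrow> 'a" where
    "c r = of_nat ((q + m r + (\<Sum>s\<in>N r. m s) - 1) choose m r)" for r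
  define w :: "nat set \<Rightarrow> 'a" where "w S = (-1) ^ card S * (\<Prod>r=1..k. b S r)" for S
  let ?k = "Suc k"
  \<comment> \<open>These are the sets to which the new vertex \<open>Suc k\<close> can be
    added.\<close>
  define E where "E = {S \<in> Ind k. N ?k \<inter> S = {} \<and> m ?k > 0}"
  have fin [simp]: "finite (Ind k)" for k
    by (rule finite_subset[of _ "Pow {1..k}"]) (auto simp: Ind_def)
  have finE [simp]: "finite E" by (simp add: E_def)
  have finN: "finite (N r)" for r
    by (rule finite_subset[OF N_less]) simp
  have notin: "r \<notin> S" if "S \<in> Ind k" "r > k" for S r
    using that by (auto simp: Ind_def)
  have Ind_Suc: "Ind ?k = Ind k \<union> insert ?k ` E"
  proof (intro equalityI subsetI)
    fix S assume S: "S \<in> Ind ?k"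
    show "S \<in> Ind k \<union> insert ?k ` E"
    proof (cases "?k \<in> S")
      case True
      then have "S - {?k} \<in> E" using S
        by (auto simp: Ind_def E_def le_Suc_eq)
      moreover have "S = insert ?k (S - {?k})" using True by auto
      ultimately show ?thesis by blast
    next
      case False
      then have "S \<in> Ind k" using S by (auto simp: Ind_def le_Suc_eq)
      then show ?thesis by blast
    qed
  next
    fix S assume "S \<in> Ind k \<union> insert ?k ` E"
    then show "S \<in> Ind ?k"
    proof
      assume "S \<in> Ind k"
      then show ?thesis by (auto simp: Ind_def)
    next
      assume "S \<in> insert ?k ` E"
      then obtain T where T: "S = insert ?k T" "T \<in> E" by blast
      \<comment> \<open>Lower neighbours are smaller, so adding the top vertex cannot violate the
        condition at an older vertex.\<close>
      have "?k \<notin> N r" if "r \<le> ?k" for r using N_less[of r] that by auto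
      then show ?thesis using T by (auto simp: Ind_def E_def)
    qed
  qed
  \<comment> \<open>Factor \<open>r\<close> depends on \<open>S\<close> only through
    \<open>r\<close> and smaller vertices, so it does not see \<open>Suc k\<close>.\<close>
  have b_insert: "b (insert ?k S) r = b S r" if "r \<le> k" for S r
  proof -
    have "(\<Sum>s\<in>N r. m s - of_bool (s \<in> insert ?k S)) = (\<Sum>s\<in>N r. m s - of_bool (s \<in> S))"
      by (rule sum.cong) (use N_less[of r] that in auto)
    then show ?thesis using that by (simp add: b_def)
  qed
  have w_insert: "(-1) ^ card (insert ?k S) * (\<Prod>r=1..k. b (insert ?k S) r) = - w S"
    if "S \<in> Ind k" for S
  proof -
    have "card (insert ?k S) = Suc (card S)"
      using that notin[OF that, of ?k] finite_subset[of S "{1..k}"] by (simp add: Ind_def)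
    moreover have "(\<Prod>r=1..k. b (insert ?k S) r) = (\<Prod>r=1..k. b S r)"
      by (rule prod.cong) (auto simp: b_insert)
    ultimately show ?thesis by (simp add: w_def)
  qed
  \<comment> \<open>Over both choices for \<open>Suc k\<close>, its total contribution is
    independent of \<open>S\<close>; this is what lets \<open>c (Suc k)\<close> leave the
    sum.\<close>
  have factor: "b S ?k - (if N ?k \<inter> S = {} \<and> m ?k > 0 then b (insert ?k S) ?k else 0) = c ?k"
    if S: "S \<in> Ind k" for S
  proof -
    let ?A = "\<Sum>s\<in>N ?k. m s"
    have pos: "m s > 0" if "s \<in> S" for s using S that by (auto simp: Ind_def)
    have k: "?k \<notin> S" using notin[OF S] by simp
    have "(\<Sum>s\<in>N ?k. m s - of_bool (s \<in> insert ?k S)) = (\<Sum>s\<in>N ?k. m s - of_bool (s \<in> S))"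
      by (rule sum.cong) (use N_less[of ?k] in auto)
    then have b_ins: "b (insert ?k S) ?k =
      of_nat ((q + (m ?k - 1) + (?A - card (N ?k \<inter> S))) choose (m ?k - 1))"
      by (simp add: b_def sum_decrement_on_subset[OF finN pos])
    have b: "b S ?k = of_nat ((q + m ?k + (?A - card (N ?k \<inter> S))) choose m ?k)"
      using k by (simp add: b_def sum_decrement_on_subset[OF finN pos])
    show ?thesis
    proof (cases "N ?k \<inter> S = {}")
      case True
      show ?thesis
      proof (cases "m ?k")
        \<comment> \<open>Both binomials have lower entry 0, hence equal 1 even where the
          subtraction in \<open>c\<close> truncates.\<close>
        case 0
        then show ?thesis by (simp add: b c_def)
      next
        case (Suc j)
        \<comment> \<open>Pascal's rule:
          \<open>(M + 1 choose j + 1) - (M choose j) = (M choose j + 1)\<close> with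
          \<open>M = q + j + ?A\<close>.\<close>
        then show ?thesis using True by (simp add: b b_ins c_def)
      qed
    next
      case False
      then obtain t where t: "t \<in> N ?k" "t \<in> S" by blast
      \<comment> \<open>Two distinct chosen neighbours of \<open>Suc k\<close> would be joined by
        the clique condition, against independence.\<close>
      have "s = t" if "s \<in> N ?k" "s \<in> S" for s
      proof (rule ccontr)
        assume "s \<noteq> t"
        then have "s \<in> N t \<or> t \<in> N s"
          using clique[OF that(1) t(1)] clique[OF t(1) that(1)] by (metis nat_neq_iff)
        then show False using S that(2) t(2) by (auto simp: Ind_def)
      qed
      then have "N ?k \<inter> S = {t}" using t by blast
      \<comment> \<open>Lets the decrement caused by \<open>t\<close> move from the neighbour sum to
        the whole upper entry, where \<open>c\<close> has its \<open>- 1\<close>.\<close>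
      moreover have "?A \<ge> 1"
        using member_le_sum[OF t(1), of m] finN[of ?k] pos[OF t(2)] by simp
      ultimately show ?thesis by (simp add: b c_def)
    qed
  qed
  have "(\<Sum>S\<in>Ind ?k. (-1) ^ card S * (\<Prod>r=1..?k. b S r)) =
        (\<Sum>S\<in>Ind k. (-1) ^ card S * (\<Prod>r=1..?k. b S r)) +
        (\<Sum>S\<in>insert ?k ` E. (-1) ^ card S * (\<Prod>r=1..?k. b S r))"
    unfolding Ind_Suc by (rule sum.union_disjoint) (auto dest: notin[of _ ?k])
  also have "(\<Sum>S\<in>insert ?k ` E. (-1) ^ card S * (\<Prod>r=1..?k. b S r)) =
        (\<Sum>S\<in>E. (-1) ^ card (insert ?k S) * (\<Prod>r=1..?k. b (insert ?k S) r))"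
  proof (subst sum.reindex)
    show "inj_on (insert ?k) E"
      by (rule inj_onI) (metis (no_types, lifting) E_def insert_ident lessI mem_Collect_eq notin)
  qed simp
  also have "\<dots> = (\<Sum>S\<in>E. - w S * b (insert ?k S) ?k)"
    by (rule sum.cong) (use w_insert in \<open>auto simp: E_def mult.assoc[symmetric]\<close>)
  \<comment> \<open>Extension by zero puts both sums over \<open>Ind k\<close>, so that
    \<open>factor\<close> applies term by term.\<close>
  also have "\<dots> = (\<Sum>S\<in>Ind k. if N ?k \<inter> S = {} \<and> m ?k > 0 then - w S * b (insert ?k S) ?k else 0)"
    unfolding E_def by (rule sum.inter_filter) simp
  also have "(\<Sum>S\<in>Ind k. (-1) ^ card S * (\<Prod>r=1..?k. b S r)) = (\<Sum>S\<in>Ind k. w S * b S ?k)"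
    by (simp add: w_def mult.assoc)
  also have "(\<Sum>S\<in>Ind k. w S * b S ?k) +
      (\<Sum>S\<in>Ind k. if N ?k \<inter> S = {} \<and> m ?k > 0 then - w S * b (insert ?k S) ?k else 0) =
      (\<Sum>S\<in>Ind k. w S * c ?k)"
    unfolding sum.distrib[symmetric]
    by (rule sum.cong) (auto simp: factor[symmetric] algebra_simps)
  also have "\<dots> = (\<Prod>r=1..?k. c r)"
    using Suc.IH unfolding Ind_def[symmetric] b_def[symmetric] c_def[symmetric]
    by (simp add: w_def sum_distrib_right[symmetric])
  finally show ?case
    unfolding Ind_def b_def c_def .
qed

section \<open>Powers of the inverse independence polynomial\<close>

definition lower_nbrs :: "(nat, 'b) pre_digraph \<Rightarrow> nat \<Rightarrow> nat set" where
  "lower_nbrs G r = {s. 1 \<le> s \<and> s < r \<and> s \<rightarrow>\<^bsub>G\<^esub> r}"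

lemma lower_nbrs_subset: "lower_nbrs G r \<subseteq> {1..<r}"
  by (auto simp: lower_nbrs_def)

lemma finite_lower_nbrs [simp]: "finite (lower_nbrs G r)"
  by (rule finite_subset[OF lower_nbrs_subset]) simp

lemma lower_nbr_sum_eq:
  "lower_nbr_sum G m r = Poly_Mapping.lookup m r + (\<Sum>s\<in>lower_nbrs G r. Poly_Mapping.lookup m s)"
  by (simp add: lower_nbr_sum_def lower_nbrs_def)

text \<open>Both \<open>s\<close> and \<open>t\<close> lie in the set \<open>W\<close> that the
  ordering attaches to \<open>r\<close>, and \<open>W\<close> induces a complete graph.\<close>

lemma lower_nbrs_clique:
  assumes "graph G" and verts: "verts G = {1..n}"
    and peo: "perfect_elimination_ordering G {(i, j). i \<in> {1..n} \<and> j \<in> {1..n} \<and> i \<le> j}"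
    and "s \<in> lower_nbrs G r" "t \<in> lower_nbrs G r" "s < t"
  shows "s \<in> lower_nbrs G t"
proof -
  interpret graph G by fact
  have mem: "s \<in> verts G" "t \<in> verts G" "r \<in> verts G" "s < r" "t < r" "s \<rightarrow>\<^bsub>G\<^esub> r" "t \<rightarrow>\<^bsub>G\<^esub> r"
    using assms(4,5) by (auto simp: lower_nbrs_def dest: adj_in_verts)
  define W where "W = insert r {i\<in>verts G. (i, r) \<in> {(i, j). i \<in> {1..n} \<and> j \<in> {1..n} \<and> i \<le> j} \<and>
    i \<rightarrow>\<^bsub>G\<^esub> r}"
  have "complete_digraph (card W) (G \<restriction> W)"
    using peo mem(3) unfolding perfect_elimination_ordering_def W_def Let_def by blast
  then have "s \<rightarrow>\<^bsub>G \<restriction> W\<^esub> t"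
    using mem verts \<open>s < t\<close> by (auto simp: complete_digraph_def W_def)
  then have "s \<rightarrow>\<^bsub>G\<^esub> t" by (rule dominates_induce_subgraphD)
  with assms(4,6) show ?thesis by (auto simp: lower_nbrs_def)
qed

text \<open>Adjacency is symmetric and loop-free, so an edge inside \<open>S\<close> is detected at
  its larger endpoint.\<close>

lemma independent_sets_iff_lower_nbrs:
  assumes "graph G" and verts: "verts G = {1..n}"
  shows "independent_sets G = {S. S \<subseteq> {1..n} \<and> (\<forall>r\<in>S. lower_nbrs G r \<inter> S = {})}"
proof -
  interpret graph G by fact
  have "\<not> u \<rightarrow>\<^bsub>G\<^esub> v"
    if "S \<subseteq> {1..n}" "\<forall>r\<in>S. lower_nbrs G r \<inter> S = {}" "u \<in> S" "v \<in> S" for S u v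
  proof
    assume uv: "u \<rightarrow>\<^bsub>G\<^esub> v"
    then have "v \<rightarrow>\<^bsub>G\<^esub> u" by (rule graph_symmetric)
    moreover have "u \<noteq> v" using uv adj_not_same by auto
    moreover have "1 \<le> u" "1 \<le> v" using that by auto
    ultimately have "u \<in> lower_nbrs G v \<or> v \<in> lower_nbrs G u"
      using uv by (auto simp: lower_nbrs_def)
    then show False using that by blast
  qed
  then show ?thesis
    unfolding independent_sets_def verts by (auto simp: lower_nbrs_def)
qed

text \<open>
  For \<open>q \<ge> 1\<close> this is the series of the theorem. Placing the truncated subtraction last
  makes it meaningful for \<open>q = 0\<close> as well.
\<close>

definition inverse_power_coeff :: "(nat, 'e) pre_digraph \<Rightarrow> nat \<Rightarrow> nat \<Rightarrow> (nat \<Rightarrow>\<^sub>0 nat) \<Rightarrow> rat" where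
  "inverse_power_coeff G n q m = (-1) ^ (\<Sum>i=1..n. Poly_Mapping.lookup m i) *
     (\<Prod>r=1..n. of_nat ((q + lower_nbr_sum G m r - 1) choose (Poly_Mapping.lookup m r)))"

text \<open>At the least vertex \<open>r\<close> of a nonempty support the neighbour sum vanishes,
  so the upper entry is one less than the lower one and the factor is 0.\<close>

lemma inverse_power_series_0: "mfps_series {1..n} (inverse_power_coeff G n 0) = 1"
proof (rule mfps_eqI)
  fix m :: "nat \<Rightarrow>\<^sub>0 nat"
  show "mfps_coeff (mfps_series {1..n} (inverse_power_coeff G n 0)) m = mfps_coeff 1 m"
  proof (cases "Poly_Mapping.keys m \<subseteq> {1..n} \<and> m \<noteq> 0")
    case True
    define r where "r = Min (Poly_Mapping.keys m)"
    have ne: "Poly_Mapping.keys m \<noteq> {}" using True by simp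
    then have r: "r \<in> Poly_Mapping.keys m" by (simp add: r_def)
    have "Poly_Mapping.lookup m s = 0" if "s < r" for s
    proof (rule ccontr)
      assume "Poly_Mapping.lookup m s \<noteq> 0"
      then have "r \<le> s" by (simp add: r_def in_keys_iff)
      with that show False by simp
    qed
    then have "lower_nbr_sum G m r = Poly_Mapping.lookup m r"
      by (simp add: lower_nbr_sum_def)
    then have "(0 + lower_nbr_sum G m r - 1) choose (Poly_Mapping.lookup m r) = 0"
      using r by (simp add: in_keys_iff binomial_eq_0)
    then have "(\<Prod>r=1..n. of_nat ((0 + lower_nbr_sum G m r - 1) choose (Poly_Mapping.lookup m r)))
        = (0 :: rat)"
      using r True by (intro prod_zero) auto
    with True show ?thesis
      by (simp add: mfps_series.rep_eq one_mfps.rep_eq inverse_power_coeff_def)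
  next
    case False
    then show ?thesis
      by (auto simp: mfps_series.rep_eq one_mfps.rep_eq inverse_power_coeff_def)
  qed
qed

text \<open>At \<open>Suc q\<close> the \<open>- 1\<close> in the upper entries cancels, so each
  coefficient of the product becomes, up to a common sign, the left-hand side of
  \<open>alternating_sum_independent\<close>.\<close>

lemma independence_poly_mult_series:
  assumes G: "graph G" and verts: "verts G = {1..n}"
    and peo: "perfect_elimination_ordering G {(i, j). i \<in> {1..n} \<and> j \<in> {1..n} \<and> i \<le> j}"
  shows "independence_poly G * mfps_series {1..n} (inverse_power_coeff G n (Suc q)) =
    mfps_series {1..n} (inverse_power_coeff G n q)"
proof (rule mfps_eqI)
  fix m :: "nat \<Rightarrow>\<^sub>0 nat"
  let ?I = "{1..n}"
  let ?F = "mfps_series ?I (inverse_power_coeff G n (Suc q))"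
  let ?l = "Poly_Mapping.lookup m"
  define e where "e S = (\<Sum>i\<in>S. Poly_Mapping.single i (1::nat))" for S :: "nat set"
  note indep = independent_sets_iff_lower_nbrs[OF G verts]
  have fin: "finite S" if "S \<in> independent_sets G" for S
    using that finite_subset[of S ?I] by (simp add: indep)
  have finI: "finite (independent_sets G)"
    by (rule finite_subset[of _ "Pow ?I"]) (auto simp: indep)
  have lookup_diff: "Poly_Mapping.lookup (m - e S) i = ?l i - of_bool (i \<in> S)"
    if "S \<in> independent_sets G" for S i
    using fin[OF that] by (simp add: e_def lookup_minus lookup_sum_single_one del: One_nat_def)
  have "mfps_coeff (independence_poly G * ?F) m =
    (\<Sum>S\<in>independent_sets G. mfps_coeff ((\<Prod>i\<in>S. mfps_X i) * ?F) m)"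
    by (simp add: independence_poly_def sum_distrib_right mfps_coeff_sum)
  also have "\<dots> = (\<Sum>S\<in>independent_sets G.
      if S \<subseteq> Poly_Mapping.keys m then mfps_coeff ?F (m - e S) else 0)"
    unfolding e_def by (rule sum.cong[OF refl], rule mfps_coeff_prod_X_mult, rule fin)
  also have "\<dots> = (\<Sum>S | S \<in> independent_sets G \<and> S \<subseteq> Poly_Mapping.keys m. mfps_coeff ?F (m - e S))"
    by (rule sum.inter_filter[symmetric, OF finI])
  also have "\<dots> = mfps_coeff (mfps_series ?I (inverse_power_coeff G n q)) m"
  proof (cases "Poly_Mapping.keys m \<subseteq> ?I")
    case True
    let ?B = "\<lambda>S. (\<Prod>r\<in>?I. of_nat ((q + (?l r - of_bool (r \<in> S)) +
      (\<Sum>s\<in>lower_nbrs G r. ?l s - of_bool (s \<in> S))) choose (?l r - of_bool (r \<in> S)))) :: rat"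
    \<comment> \<open>Positivity of the exponents encodes inclusion in the support.\<close>
    have indep_in_keys: "{S. S \<in> independent_sets G \<and> S \<subseteq> Poly_Mapping.keys m} =
      {S. S \<subseteq> ?I \<and> (\<forall>r\<in>S. lower_nbrs G r \<inter> S = {} \<and> ?l r > 0)}"
      unfolding indep by (auto simp: in_keys_iff subset_iff)
    have "mfps_coeff ?F (m - e S) = (-1) ^ (\<Sum>i\<in>?I. ?l i) * ((-1) ^ card S * ?B S)"
      if S: "S \<in> independent_sets G" "S \<subseteq> Poly_Mapping.keys m" for S
    proof -
      have pos: "?l s > 0" if "s \<in> S" for s using S(2) that by (auto simp: in_keys_iff)
      have "S \<subseteq> ?I" using S by (simp add: indep)
      then have "?I \<inter> S = S" by blast
      then have deg: "(\<Sum>i\<in>?I. Poly_Mapping.lookup (m - e S) i) = (\<Sum>i\<in>?I. ?l i) - card S"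
        by (simp only: lookup_diff[OF S(1)] sum_decrement_on_subset[OF finite_atLeastAtMost pos])
      \<comment> \<open>The degree is at least \<open>card S\<close>, so the truncated difference
        has the right parity and the sign splits.\<close>
      have "card S = (\<Sum>i\<in>S. 1)" by simp
      also have "\<dots> \<le> (\<Sum>i\<in>S. ?l i)" by (rule sum_mono) (use pos in \<open>simp add: Suc_le_eq\<close>)
      also have "\<dots> \<le> (\<Sum>i\<in>?I. ?l i)" by (rule sum_mono2) (use \<open>S \<subseteq> ?I\<close> in auto)
      finally have "(-1 :: rat) ^ (\<Sum>i\<in>?I. Poly_Mapping.lookup (m - e S) i) =
          (-1) ^ (\<Sum>i\<in>?I. ?l i) * (-1) ^ card S"
        unfolding deg by (simp add: power_add[symmetric] minus_one_power_iff)
      moreover have "Poly_Mapping.keys (m - e S) \<subseteq> ?I"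
        using True by (auto simp: in_keys_iff lookup_diff[OF S(1)])
      ultimately show ?thesis
        by (simp add: mfps_series.rep_eq inverse_power_coeff_def lower_nbr_sum_eq
            lookup_diff[OF S(1)] mult.assoc add.assoc)
    qed
    then have "(\<Sum>S | S \<in> independent_sets G \<and> S \<subseteq> Poly_Mapping.keys m. mfps_coeff ?F (m - e S)) =
      (-1) ^ (\<Sum>i\<in>?I. ?l i) * (\<Sum>S | S \<in> independent_sets G \<and> S \<subseteq> Poly_Mapping.keys m. (-1) ^ card S * ?B S)"
      unfolding sum_distrib_left by (intro sum.cong refl) blast
    also have "(\<Sum>S | S \<in> independent_sets G \<and> S \<subseteq> Poly_Mapping.keys m. (-1) ^ card S * ?B S) =
      (\<Prod>r\<in>?I. of_nat ((q + ?l r + (\<Sum>s\<in>lower_nbrs G r. ?l s) - 1) choose ?l r))"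
      unfolding indep_in_keys
      by (rule alternating_sum_independent[OF lower_nbrs_subset])
        (rule lower_nbrs_clique[OF G verts peo])
    also have "(-1) ^ (\<Sum>i\<in>?I. ?l i) * \<dots> = mfps_coeff (mfps_series ?I (inverse_power_coeff G n q)) m"
      using True by (simp add: mfps_series.rep_eq inverse_power_coeff_def lower_nbr_sum_eq add.assoc)
    finally show ?thesis .
  next
    case False
    \<comment> \<open>A variable outside \<open>{1..n}\<close> is never divided out by
      \<open>S\<close>, so both coefficients are 0.\<close>
    then obtain i where i: "i \<in> Poly_Mapping.keys m" "i \<notin> ?I" by blast
    have "mfps_coeff ?F (m - e S) = 0" if "S \<in> independent_sets G" for S
    proof -
      have "i \<notin> S" using that i(2) by (auto simp: indep)
      then have "i \<in> Poly_Mapping.keys (m - e S)"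
        using i(1) by (simp add: in_keys_iff lookup_diff[OF that])
      then have "\<not> Poly_Mapping.keys (m - e S) \<subseteq> ?I" using i(2) by blast
      then show ?thesis by (simp only: mfps_series.rep_eq if_False)
    qed
    then show ?thesis
      using False by (simp add: mfps_series.rep_eq)
  qed
  finally show "mfps_coeff (independence_poly G * ?F) m =
    mfps_coeff (mfps_series ?I (inverse_power_coeff G n q)) m" .
qed

text \<open>The constant term 1 makes the polynomial a unit, so the recursion in \<open>q\<close>
  can be solved for the series at \<open>Suc q\<close>.\<close>

lemma inverse_independence_poly_power:
  assumes "graph G" "verts G = {1..n}"
    "perfect_elimination_ordering G {(i, j). i \<in> {1..n} \<and> j \<in> {1..n} \<and> i \<le> j}"
  shows "inverse (independence_poly G) ^ q = mfps_series {1..n} (inverse_power_coeff G n q)"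
proof (induction q)
  case 0
  then show ?case by (simp only: inverse_power_series_0 power_0)
next
  case (Suc q)
  let ?P = "independence_poly G" and ?F = "\<lambda>q. mfps_series {1..n} (inverse_power_coeff G n q)"
  have inv: "?P * inverse ?P = 1"
    by (rule mfps_right_inverse) (simp add: independence_poly_const_coeff[OF assms(1)])
  have "inverse ?P ^ Suc q = inverse ?P * (?P * ?F (Suc q))"
    by (simp only: power_Suc Suc.IH independence_poly_mult_series[OF assms])
  also have "\<dots> = (?P * inverse ?P) * ?F (Suc q)" by (simp only: mult_ac)
  finally show ?case by (simp only: inv mult_1)
qed

section \<open>Polynomial functions\<close>

definition exponent_monomial :: "('v \<Rightarrow>\<^sub>0 nat) \<Rightarrow> ('v \<Rightarrow> rat) \<Rightarrow> rat" where
  "exponent_monomial t x = (\<Prod>j\<in>Poly_Mapping.keys t. x j ^ Poly_Mapping.lookup t j)"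

lemma exponent_monomial_superset:
  assumes "finite A" "Poly_Mapping.keys t \<subseteq> A"
  shows "exponent_monomial t x = (\<Prod>j\<in>A. x j ^ Poly_Mapping.lookup t j)"
  unfolding exponent_monomial_def
  by (rule prod.mono_neutral_left) (use assms in \<open>auto simp: in_keys_iff\<close>)

lemma exponent_monomial_add:
  "exponent_monomial (s + t) x = exponent_monomial s x * exponent_monomial t x"
proof -
  let ?A = "Poly_Mapping.keys s \<union> Poly_Mapping.keys t"
  have "exponent_monomial (s + t) x = (\<Prod>j\<in>?A. x j ^ Poly_Mapping.lookup (s + t) j)"
    by (rule exponent_monomial_superset) (simp_all add: Poly_Mapping.keys_add)
  then show ?thesis
    by (simp add: exponent_monomial_superset[of ?A] lookup_add power_add prod.distrib)
qed

lemma ratpoly_eval_eq: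
  "ratpoly_eval p x =
     (\<Sum>t\<in>Poly_Mapping.keys p. Poly_Mapping.lookup p t * exponent_monomial t x)"
  by (simp add: ratpoly_eval_def exponent_monomial_def)

lemma ratpoly_eval_single: "ratpoly_eval (Poly_Mapping.single t c) x = c * exponent_monomial t x"
  by (simp add: ratpoly_eval_eq)

lemma ratpoly_eval_add: "ratpoly_eval (p + q) x = ratpoly_eval p x + ratpoly_eval q x"
  unfolding ratpoly_eval_eq by (rule setsum_keys_plus_distrib) (simp_all add: distrib_right)

text \<open>Reduces additive statements to monomials; unlike in \<open>update_induct\<close>,
  \<open>t\<close> may already occur in \<open>p\<close>.\<close>

lemma ratpoly_induct [case_names zero add_single]:
  fixes p :: "'v ratpoly"
  assumes "P 0" "\<And>p t c. P p \<Longrightarrow> P (p + Poly_Mapping.single t c)"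
  shows "P p"
proof (induction p rule: Poly_Mapping.update_induct)
  case (update f a b)
  have "Poly_Mapping.update a b f = f + Poly_Mapping.single a b"
    by (rule poly_mapping_eqI)
      (use update in \<open>auto simp: lookup_update lookup_add lookup_single when_def in_keys_iff\<close>)
  with update assms(2) show ?case by metis
qed (rule assms(1))

text \<open>Both sides are additive in each factor, so a nested induction leaves products of two
  monomials.\<close>

lemma ratpoly_eval_mult: "ratpoly_eval (p * q) x = ratpoly_eval p x * ratpoly_eval q x"
proof (induction p rule: ratpoly_induct)
  case zero
  then show ?case by (simp add: ratpoly_eval_def)
next
  case (add_single p t c)
  have "ratpoly_eval (Poly_Mapping.single t c * q) x =
      ratpoly_eval (Poly_Mapping.single t c) x * ratpoly_eval q x"
  proof (induction q rule: ratpoly_induct)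
    case zero
    then show ?case by (simp add: ratpoly_eval_def)
  next
    case (add_single q s d)
    then show ?case
      by (simp add: distrib_left ratpoly_eval_add mult_single ratpoly_eval_single
          exponent_monomial_add)
  qed
  with add_single show ?case by (simp add: distrib_right ratpoly_eval_add)
qed

text \<open>Working with functions allows numerators and denominators to be assembled by closure
  rules, without handling coefficients.\<close>

definition polynomial_fun :: "'v set \<Rightarrow> (('v \<Rightarrow> rat) \<Rightarrow> rat) \<Rightarrow> bool" where
  "polynomial_fun J f \<longleftrightarrow> (\<exists>p\<in>ratpoly_in J. \<forall>x. ratpoly_eval p x = f x)"

lemma polynomial_fun_const: "polynomial_fun J (\<lambda>x. c)"
  unfolding polynomial_fun_def
  by (rule bexI[of _ "Poly_Mapping.single 0 c"])
    (auto simp: ratpoly_eval_single exponent_monomial_def ratpoly_in_def split: if_splits)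

lemma polynomial_fun_var: "j \<in> J \<Longrightarrow> polynomial_fun J (\<lambda>x. x j)"
  unfolding polynomial_fun_def
  by (rule bexI[of _ "Poly_Mapping.single (Poly_Mapping.single j 1) 1"])
    (auto simp: ratpoly_eval_single exponent_monomial_def ratpoly_in_def split: if_splits)

lemma polynomial_fun_add:
  assumes "polynomial_fun J f" "polynomial_fun J g"
  shows "polynomial_fun J (\<lambda>x. f x + g x)"
proof -
  obtain p q where p: "p \<in> ratpoly_in J" "\<And>x. ratpoly_eval p x = f x"
    and q: "q \<in> ratpoly_in J" "\<And>x. ratpoly_eval q x = g x"
    using assms unfolding polynomial_fun_def by blast
  have "p + q \<in> ratpoly_in J"
    using p(1) q(1) Poly_Mapping.keys_add[of p q] unfolding ratpoly_in_def by blast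
  then show ?thesis
    unfolding polynomial_fun_def by (rule bexI[rotated]) (simp add: ratpoly_eval_add p q)
qed

lemma polynomial_fun_mult:
  assumes "polynomial_fun J f" "polynomial_fun J g"
  shows "polynomial_fun J (\<lambda>x. f x * g x)"
proof -
  obtain p q where p: "p \<in> ratpoly_in J" "\<And>x. ratpoly_eval p x = f x"
    and q: "q \<in> ratpoly_in J" "\<And>x. ratpoly_eval q x = g x"
    using assms unfolding polynomial_fun_def by blast
  have "Poly_Mapping.keys t \<subseteq> J" if t: "t \<in> Poly_Mapping.keys (p * q)" for t
  proof -
    obtain a b where "t = a + b" "a \<in> Poly_Mapping.keys p" "b \<in> Poly_Mapping.keys q"
      using t keys_mult[of p q] by blast
    then show ?thesis
      using p(1) q(1) Poly_Mapping.keys_add[of a b] unfolding ratpoly_in_def by blast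
  qed
  then have "p * q \<in> ratpoly_in J" by (simp add: ratpoly_in_def)
  then show ?thesis
    unfolding polynomial_fun_def by (rule bexI[rotated]) (simp add: ratpoly_eval_mult p q)
qed

lemma polynomial_fun_sum:
  assumes "\<And>a. a \<in> A \<Longrightarrow> polynomial_fun J (f a)"
  shows "polynomial_fun J (\<lambda>x. \<Sum>a\<in>A. f a x)"
  using assms
  by (induction A rule: infinite_finite_induct)
    (simp_all add: polynomial_fun_const polynomial_fun_add)

lemma polynomial_fun_prod:
  assumes "\<And>a. a \<in> A \<Longrightarrow> polynomial_fun J (f a)"
  shows "polynomial_fun J (\<lambda>x. \<Prod>a\<in>A. f a x)"
  using assms
  by (induction A rule: infinite_finite_induct)
    (simp_all add: polynomial_fun_const polynomial_fun_mult)

text \<open>Passes from polynomial functions to polynomials; \<open>Q \<noteq> 0\<close> follows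
  from a single point where \<open>g\<close> does not vanish.\<close>

lemma horn_hypergeometricI:
  assumes "F \<in> mfps_over I"
    and "\<And>m. Poly_Mapping.keys m \<subseteq> I \<Longrightarrow> mfps_coeff F m \<noteq> 0"
    and "\<And>J i. finite J \<Longrightarrow> J \<subseteq> I \<Longrightarrow> i \<in> J \<Longrightarrow> \<exists>f g. polynomial_fun J f \<and> polynomial_fun J g \<and>
      (\<forall>m. Poly_Mapping.keys m = J \<longrightarrow> g (\<lambda>j. of_nat (Poly_Mapping.lookup m j)) \<noteq> 0 \<and>
         mfps_coeff F (m + Poly_Mapping.single i 1) / mfps_coeff F m =
           f (\<lambda>j. of_nat (Poly_Mapping.lookup m j)) / g (\<lambda>j. of_nat (Poly_Mapping.lookup m j)))"
    and "finite I"
  shows "horn_hypergeometric I F"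
  unfolding horn_hypergeometric_def
proof (intro conjI allI impI ballI)
  fix J i assume J: "J \<subseteq> I" "i \<in> J"
  define X :: "('a \<Rightarrow>\<^sub>0 nat) \<Rightarrow> 'a \<Rightarrow> rat" where "X m j = of_nat (Poly_Mapping.lookup m j)" for m j
  have fin: "finite J" using J(1) assms(4) by (rule finite_subset)
  obtain f g where fg: "polynomial_fun J f" "polynomial_fun J g"
    "\<And>m. Poly_Mapping.keys m = J \<Longrightarrow> g (X m) \<noteq> 0 \<and>
       mfps_coeff F (m + Poly_Mapping.single i 1) / mfps_coeff F m = f (X m) / g (X m)"
    using assms(3)[OF fin J] unfolding X_def[abs_def] by blast
  obtain P Q where P: "P \<in> ratpoly_in J" "\<And>x. ratpoly_eval P x = f x"
    and Q: "Q \<in> ratpoly_in J" "\<And>x. ratpoly_eval Q x = g x"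
    using fg(1,2) unfolding polynomial_fun_def by blast
  \<comment> \<open>The all-ones exponent on \<open>J\<close> has support exactly \<open>J\<close>
    and serves as that point.\<close>
  define m where "m = (\<Sum>j\<in>J. Poly_Mapping.single j (1::nat))"
  have "Poly_Mapping.keys m = J"
    using fin by (auto simp: m_def in_keys_iff lookup_sum_single_one simp del: One_nat_def)
  then have "ratpoly_eval Q (X m) \<noteq> 0" using fg(3) Q(2) by simp
  then have "Q \<noteq> 0" by (auto simp: ratpoly_eval_def)
  then show "\<exists>P\<in>ratpoly_in J. \<exists>Q\<in>ratpoly_in J. Q \<noteq> 0 \<and>
    (\<forall>m. Poly_Mapping.keys m = J \<longrightarrow>
       ratpoly_eval Q (\<lambda>j. of_nat (Poly_Mapping.lookup m j)) \<noteq> 0 \<and>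
       mfps_coeff F (m + Poly_Mapping.single i 1) / mfps_coeff F m =
         ratpoly_eval P (\<lambda>j. of_nat (Poly_Mapping.lookup m j)) /
         ratpoly_eval Q (\<lambda>j. of_nat (Poly_Mapping.lookup m j)))"
    using P Q fg(3) unfolding X_def[abs_def] by metis
qed (use assms(1,2) in auto)

section \<open>The Horn property\<close>

text \<open>Absorption identity, for the factor of the vertex \<open>i\<close> whose exponent is
  raised: both entries grow.\<close>

lemma binomial_ratio_Suc_Suc:
  assumes "k \<le> N"
  shows "(of_nat (Suc N choose Suc k) :: 'a :: field_char_0) / of_nat (N choose k) =
    of_nat (Suc N) / of_nat (Suc k)"
proof -
  have "(of_nat (Suc k) :: 'a) * of_nat (Suc N choose Suc k) = of_nat (Suc N) * of_nat (N choose k)"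
    unfolding of_nat_mult[symmetric] Suc_times_binomial ..
  moreover have "(of_nat (N choose k) :: 'a) \<noteq> 0" using assms by simp
  ultimately show ?thesis
    by (simp add: frac_eq_eq mult.commute del: of_nat_Suc binomial_Suc_Suc)
qed

text \<open>Complementary absorption, for a vertex having \<open>i\<close> as a lower neighbour:
  only the upper entry grows.\<close>

lemma binomial_ratio_Suc:
  assumes "k \<le> N"
  shows "(of_nat (Suc N choose k) :: 'a :: field_char_0) / of_nat (N choose k) =
    of_nat (Suc N) / of_nat (Suc N - k)"
proof -
  have "(of_nat (Suc N - k) :: 'a) * of_nat (Suc N choose k) = of_nat (Suc N) * of_nat (N choose k)"
    unfolding of_nat_mult[symmetric] using binomial_absorb_comp[of "Suc N" k] by simp
  moreover have "(of_nat (N choose k) :: 'a) \<noteq> 0" "(of_nat (Suc N - k) :: 'a) \<noteq> 0"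
    unfolding of_nat_eq_0_iff using assms by simp_all
  ultimately show ?thesis
    by (simp add: frac_eq_eq mult.commute del: of_nat_Suc)
qed

lemma lower_nbr_sum_add_single:
  "lower_nbr_sum G (m + Poly_Mapping.single i 1) r =
     lower_nbr_sum G m r + of_bool (r = i \<or> i \<in> lower_nbrs G r)"
proof -
  have "i \<notin> lower_nbrs G r" if "r = i" using that by (simp add: lower_nbrs_def)
  then show ?thesis
    by (auto simp: lower_nbr_sum_eq lookup_add lookup_single when_def sum.distrib)
qed

text \<open>With \<open>q \<ge> 1\<close> the \<open>- 1\<close> is compensated, so no upper entry
  falls below its lower entry.\<close>

lemma inverse_power_coeff_nonzero:
  assumes "q \<ge> 1"
  shows "inverse_power_coeff G n q m \<noteq> 0"
proof -
  have "Poly_Mapping.lookup m r \<le> q + lower_nbr_sum G m r - 1" for r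
    using assms by (simp add: lower_nbr_sum_def)
  then show ?thesis by (simp add: inverse_power_coeff_def not_less)
qed

text \<open>The coefficient quotient splits into one binomial ratio per vertex, each a quotient of
  polynomials of degree at most 1.\<close>

lemma horn_hypergeometric_inverse_power_series:
  assumes q: "q \<ge> 1"
  shows "horn_hypergeometric {1..n} (mfps_series {1..n} (inverse_power_coeff G n q))"
proof (rule horn_hypergeometricI)
  let ?F = "mfps_series {1..n} (inverse_power_coeff G n q)"
  fix J i assume J: "J \<subseteq> {1..n}" "i \<in> J" and finJ: "finite J"
  \<comment> \<open>\<open>p r\<close> and \<open>d r\<close> are the numerator and denominator of
    the ratio at \<open>r\<close>, read off from the two binomial ratio lemmas. Intersecting with
    \<open>J\<close> keeps them polynomials in the allowed variables.\<close>
  define p :: "nat \<Rightarrow> (nat \<Rightarrow> rat) \<Rightarrow> rat" where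
    "p r x = (if r = i \<or> i \<in> lower_nbrs G r
       then of_nat q + (\<Sum>s\<in>J \<inter> insert r (lower_nbrs G r). x s) else 1)" for r x
  define d :: "nat \<Rightarrow> (nat \<Rightarrow> rat) \<Rightarrow> rat" where
    "d r x = (if r = i then x i + 1 else if i \<in> lower_nbrs G r
       then of_nat q + (\<Sum>s\<in>J \<inter> lower_nbrs G r. x s) else 1)" for r x
  \<comment> \<open>The factor \<open>- 1\<close> records that the degree grows by one.\<close>
  define f where "f x = - 1 * (\<Prod>r=1..n. p r x)" for x
  define g where "g x = (\<Prod>r=1..n. d r x)" for x
  have "polynomial_fun J (p r)" for r
    by (cases "r = i \<or> i \<in> lower_nbrs G r")
      (auto simp: p_def[abs_def] intro!: polynomial_fun_add polynomial_fun_const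
        polynomial_fun_sum polynomial_fun_var)
  then have f: "polynomial_fun J f"
    unfolding f_def[abs_def]
    by (intro polynomial_fun_mult polynomial_fun_const polynomial_fun_prod)
  have "polynomial_fun J (d r)" for r
    by (cases "r = i"; cases "i \<in> lower_nbrs G r")
      (auto simp: d_def[abs_def] J(2) intro!: polynomial_fun_add polynomial_fun_const
        polynomial_fun_sum polynomial_fun_var)
  then have g: "polynomial_fun J g"
    unfolding g_def[abs_def] by (intro polynomial_fun_prod)
  have "g X \<noteq> 0 \<and> mfps_coeff ?F (m + Poly_Mapping.single i 1) / mfps_coeff ?F m = f X / g X"
    if keys: "Poly_Mapping.keys m = J" and X: "X = (\<lambda>j. of_nat (Poly_Mapping.lookup m j))" for m X
  proof
    let ?l = "Poly_Mapping.lookup m" and ?m' = "m + Poly_Mapping.single i 1"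
    define b where "b m r = (of_nat ((q + lower_nbr_sum G m r - 1) choose
      (Poly_Mapping.lookup m r)) :: rat)" for m r
    \<comment> \<open>Exponents outside the support \<open>J\<close> are 0, so the restriction to
      \<open>J\<close> does not change the sums.\<close>
    have sumJ: "(\<Sum>s\<in>J \<inter> A. X s) = of_nat (\<Sum>s\<in>A. ?l s)" if "finite A" for A
      unfolding X of_nat_sum
      by (rule sum.mono_neutral_left) (use that keys in \<open>auto simp: in_keys_iff\<close>)
    have le: "?l r \<le> q + lower_nbr_sum G m r - 1" for r
      using q by (simp add: lower_nbr_sum_def)
    have p: "p r X = of_nat (q + lower_nbr_sum G m r)" if "r = i \<or> i \<in> lower_nbrs G r" for r
    proof -
      have "r \<notin> lower_nbrs G r" by (simp add: lower_nbrs_def)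
      then show ?thesis
        using that by (simp add: p_def sumJ lower_nbr_sum_eq del: Int_insert_right_if1 Int_insert_right)
    qed
    have d: "d r X = of_nat (q + lower_nbr_sum G m r - ?l r)" if "r \<noteq> i" "i \<in> lower_nbrs G r" for r
      using that by (simp add: d_def sumJ lower_nbr_sum_eq)
    have di: "d i X = of_nat (Suc (?l i))" by (simp add: d_def X)
    have "d r X \<noteq> 0" for r
    proof (cases "r = i")
      case False
      then show ?thesis
      proof (cases "i \<in> lower_nbrs G r")
        case True
        \<comment> \<open>This number is \<open>q\<close> plus the neighbour sum, so
          \<open>q \<ge> 1\<close> excludes a pole.\<close>
        have "q + lower_nbr_sum G m r - ?l r > 0" using q by (simp add: lower_nbr_sum_def)
        then show ?thesis using d[OF False True] by (metis of_nat_0_eq_iff less_numeral_extra(3))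
      qed (simp add: d_def)
    qed (simp add: di del: of_nat_Suc)
    then show "g X \<noteq> 0" by (simp add: g_def)
    have ratio: "b ?m' r / b m r = p r X / d r X" for r
    proof -
      \<comment> \<open>\<open>N\<close> is the upper entry before the exponent is raised.\<close>
      obtain N where N: "q + lower_nbr_sum G m r = Suc N"
        using q by (metis add_is_0 not_one_le_zero not0_implies_Suc)
      have leN: "?l r \<le> N" using le[of r] N by simp
      consider "r = i" | "r \<noteq> i" "i \<in> lower_nbrs G r" | "r \<noteq> i" "i \<notin> lower_nbrs G r" by blast
      then show ?thesis
      proof cases
        case 1
        then have "b ?m' r = of_nat (Suc N choose Suc (?l r))"
          unfolding b_def lower_nbr_sum_add_single
          using N by (simp add: lookup_add del: binomial_Suc_Suc)
        moreover have "b m r = of_nat (N choose ?l r)" by (simp add: b_def N)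
        moreover have "p r X = of_nat (Suc N)" using p[of r] 1 N by simp
        moreover have "d r X = of_nat (Suc (?l r))" using di 1 by simp
        ultimately show ?thesis by (simp only: binomial_ratio_Suc_Suc[OF leN])
      next
        case 2
        then have "b ?m' r = of_nat (Suc N choose ?l r)"
          unfolding b_def lower_nbr_sum_add_single
          using N by (simp add: lookup_add lookup_single)
        moreover have "b m r = of_nat (N choose ?l r)" by (simp add: b_def N)
        moreover have "p r X = of_nat (Suc N)" using p[of r] 2 N by simp
        moreover have "d r X = of_nat (Suc N - ?l r)" using d[of r] 2 N by simp
        ultimately show ?thesis by (simp only: binomial_ratio_Suc[OF leN])
      next
        case 3
        then have "b ?m' r = b m r"
          unfolding b_def lower_nbr_sum_add_single by (simp add: lookup_add lookup_single)
        moreover have "b m r \<noteq> 0" using le[of r] by (simp add: b_def)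
        ultimately show ?thesis using 3 by (simp add: p_def d_def)
      qed
    qed
    have i: "i \<in> {1..n}" using J by blast
    have deg: "(\<Sum>j=1..n. Poly_Mapping.lookup ?m' j) = Suc (\<Sum>j=1..n. ?l j)"
      using i by (simp add: lookup_add lookup_single when_def sum.distrib)
    have "Poly_Mapping.keys ?m' \<subseteq> {1..n}"
      using Poly_Mapping.keys_add[of m "Poly_Mapping.single i 1"] i keys J(1) by auto
    then have "mfps_coeff ?F ?m' / mfps_coeff ?F m =
        - (\<Prod>r=1..n. b ?m' r) / (\<Prod>r=1..n. b m r)"
      using keys J(1)
      by (simp add: mfps_series.rep_eq inverse_power_coeff_def deg b_def[symmetric] del: One_nat_def)
    also have "\<dots> = - (\<Prod>r=1..n. b ?m' r / b m r)"
      by (simp add: prod_dividef)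
    also have "\<dots> = f X / g X"
      by (simp only: ratio prod_dividef f_def g_def)
    finally show "mfps_coeff ?F ?m' / mfps_coeff ?F m = f X / g X" .
  qed
  with f g show "\<exists>f g. polynomial_fun J f \<and> polynomial_fun J g \<and>
      (\<forall>m. Poly_Mapping.keys m = J \<longrightarrow> g (\<lambda>j. of_nat (Poly_Mapping.lookup m j)) \<noteq> 0 \<and>
         mfps_coeff ?F (m + Poly_Mapping.single i 1) / mfps_coeff ?F m =
           f (\<lambda>j. of_nat (Poly_Mapping.lookup m j)) / g (\<lambda>j. of_nat (Poly_Mapping.lookup m j)))"
    by blast
qed (auto simp: mfps_over_def mfps_series.rep_eq inverse_power_coeff_nonzero[OF q])

theorem corollary1:
  fixes G :: "(nat, 'e) pre_digraph" and n :: nat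
  assumes "graph G"
    and "verts G = {1..n}"
    and "chordal G"
    and "perfect_elimination_ordering G {(i, j). i \<in> {1..n} \<and> j \<in> {1..n} \<and> i \<le> j}"
  shows "(\<forall>q::nat. q \<ge> 1 \<longrightarrow>
            independence_poly G powi (- int q) =
              mfps_series {1..n} (\<lambda>m. (-1) ^ (\<Sum>i=1..n. Poly_Mapping.lookup m i) *
                (\<Prod>r=1..n. of_nat ((q - 1 + lower_nbr_sum G m r) choose (Poly_Mapping.lookup m r))))) \<and>
         (\<forall>q::nat. q \<ge> 1 \<longrightarrow>
            horn_hypergeometric {1..n} (independence_poly G powi (- int q)))"
proof (intro conjI allI impI)
  fix q :: nat assume q: "q \<ge> 1"
  have pow: "independence_poly G powi (- int q) = mfps_series {1..n} (inverse_power_coeff G n q)"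
    using q inverse_independence_poly_power[OF assms(1,2,4), of q] by (simp add: power_int_def)
  \<comment> \<open>For \<open>q \<ge> 1\<close> the two placements of the truncated
    \<open>- 1\<close> agree.\<close>
  have "inverse_power_coeff G n q = (\<lambda>m. (-1) ^ (\<Sum>i=1..n. Poly_Mapping.lookup m i) *
      (\<Prod>r=1..n. of_nat ((q - 1 + lower_nbr_sum G m r) choose (Poly_Mapping.lookup m r))))"
    using q by (simp add: inverse_power_coeff_def fun_eq_iff)
  with pow show "independence_poly G powi (- int q) =
      mfps_series {1..n} (\<lambda>m. (-1) ^ (\<Sum>i=1..n. Poly_Mapping.lookup m i) *
        (\<Prod>r=1..n. of_nat ((q - 1 + lower_nbr_sum G m r) choose (Poly_Mapping.lookup m r))))"
    by simp
  show "horn_hypergeometric {1..n} (independence_poly G powi (- int q))"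
    unfolding pow by (rule horn_hypergeometric_inverse_power_series[OF q])
qed

end
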